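(* Let $(X,\|\cdot\|)$ be a Banach space and $K\subset X$ a cone. Let $r_1,r_2,R$ be positive numbers with $r_i\le R$ ($i=1,2$) and $r_1\neq r_2$, and let $T:\overline{B}(0,R)\cap K\to K$ be a mapping (not necessarily continuous) such that $T(\overline{B}(0,R)\cap K)$ is relatively compact and $$\{x\}\cap\mathbb{T}x\subset\{Tx\}\quad\text{for all }x\in\overline{B}(0,R)\cap K,$$ where $\mathbb{T}$ is the closed--convex envelope of $T$. Suppose that (a) $\lambda x\notin\mathbb{T}x$ for all $x\in K$ with $\|x\|=r_1$ and all $\lambda\ge 1$; (b) there exists $w\in K$ with $\|w\|\ne 0$ such that $x\notin\mathbb{T}x+\lambda w$ for all $\lambda\ge 0$ and all $x\in K$ with $\|x\|=r_2$. Then $T$ has at least one fixed point $x\in K$ with $\min\{r_1,r_2\}<\|x\|<\max\{r_1,r_2\}$.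
   Context: A cone in a Banach space $X$ is a closed convex set $K$ such that $\lambda x\in K$ for all $x\in K$, $\lambda\ge 0$, and such that $x\in K$, $-x\in K$ imply $x=0$. For $D=\overline{B}(0,R)\cap K$ (with $\overline B(0,R)$ the closed ball of radius $R$ centered at $0$), the closed--convex envelope of $T:D\to K$ is the multivalued map $\mathbb{T}:D\to 2^K$, $\mathbb{T}x=\bigcap_{\varepsilon>0}\overline{\mathrm{co}}\,T\big(\overline{B}_\varepsilon(x)\cap D\big)$, where $\overline B_\varepsilon(x)$ is the closed ball of center $x$ and radius $\varepsilon$ and $\overline{\mathrm{co}}$ denotes closed convex hull. $\mathbb{T}x+\lambda w$ denotes the set $\{y+\lambda w: y\in\mathbb Tx\}$. *)

theory Defs
  imports "HOL-Analysis.Analysis"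
begin

definition is_cone :: "'a::banach set \<Rightarrow> bool" where
  "is_cone K \<longleftrightarrow> closed K \<and> convex K \<and>
     (\<forall>x\<in>K. \<forall>l::real. l \<ge> 0 \<longrightarrow> l *\<^sub>R x \<in> K) \<and>
     (\<forall>x. x \<in> K \<and> - x \<in> K \<longrightarrow> x = 0)"

definition cc_envelope :: "('a::banach \<Rightarrow> 'a) \<Rightarrow> 'a set \<Rightarrow> 'a \<Rightarrow> 'a set" where
  "cc_envelope T D x = (\<Inter>\<epsilon>\<in>{0<..}. closure (convex hull (T ` (cball x \<epsilon> \<inter> D))))"

end

theory Submission
  imports Defs
begin

text \<open>
  Put q(s) = r2 for s \<le> 1 and let q run linearly from r2 to r1 on [1, 2]. On the part of the cone
  in the ball of radius 2, let \<pi>(y) be the multiple of y of norm q(|y|), write y = c \<pi>(y), and let G be the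
  multivalued map y \<mapsto> c \<T>(\<pi>(y)) + max(0, 1 - |y|) w. A fixed point y of G satisfies
  \<pi>(y) \<in> \<T>(\<pi>(y)) + \<lambda> w with \<lambda> \<ge> 0, which (b) excludes for |y| \<le> 1; the positive rescaling by c
  makes (a) the Leray--Schauder condition on |y| = 2. Hence a fixed point of G followed by
  the radial retraction onto the ball has 1 < |y| < 2, and \<pi>(y) is the required fixed point,
  both for r1 < r2 and for r2 < r1.

  The fixed point exists because convex combinations of values of T, formed with a partition of unity,
  turn G into continuous maps of a compact convex set, to which Schauder's theorem applies; their
  fixed points accumulate at a fixed point of the multivalued map.
\<close>

section \<open>Brouwer's theorem on finite-dimensional cubes\<close>

lemma tendsto_coordinatewise_iff:
  fixes f :: "'a \<Rightarrow> 'b \<Rightarrow> 'c::topological_space"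
  shows "(f \<longlongrightarrow> l) F \<longleftrightarrow> (\<forall>i. ((\<lambda>x. f x i) \<longlongrightarrow> l i) F)"
  using limitin_componentwise[of "\<lambda>_. euclidean" UNIV f l F]
  by (simp add: euclidean_product_topology)

text \<open>Kuhn's combinatorial lemma yields, on ever finer grids, a cell in which every coordinate
  of \<open>f x - x\<close> takes both weak signs at suitable vertices; the cells shrink along a
  subsequence to a point where each coordinate of the difference is zero. The cube sits in
  \<open>nat \<Rightarrow> real\<close>, with zeros from \<open>n\<close> on, so that the dimension
  is a variable and not a type; compactness then comes from Tychonoff's theorem.\<close>

lemma brouwer_nat_cube:
  fixes f :: "(nat \<Rightarrow> real) \<Rightarrow> nat \<Rightarrow> real" and n :: nat
  defines "C \<equiv> {x. (\<forall>i<n. x i \<in> {0..1}) \<and> (\<forall>i\<ge>n. x i = 0)}"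
  assumes cont: "\<And>i. i < n \<Longrightarrow> continuous_on C (\<lambda>x. f x i)"
    and range: "\<And>x i. x \<in> C \<Longrightarrow> i < n \<Longrightarrow> f x i \<in> {0..1}"
  obtains x where "x \<in> C" "\<And>i. i < n \<Longrightarrow> f x i = x i"
proof -
  have "C = PiE UNIV (\<lambda>i. if i < n then {0..1} else {0})"
    by (rule set_eqI) (simp add: C_def PiE_UNIV_domain Pi_iff if_distrib[of "(\<in>) _"] split: if_split, meson not_le)
  moreover have "compactin (product_topology (\<lambda>i. euclidean) UNIV)
      (PiE UNIV (\<lambda>i::nat. if i < n then {0..1} else {0::real}))"
    by (subst compactin_PiE) auto
  ultimately have "compact C"
    by (simp add: euclidean_product_topology)
  define pt :: "nat \<Rightarrow> (nat \<Rightarrow> nat) \<Rightarrow> nat \<Rightarrow> real" 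
    where "pt p q = (\<lambda>i. if i < n then real (q i) / real p else 0)" for p q
  have pt_in: "pt p q \<in> C" if "0 < p" "\<And>i. i < n \<Longrightarrow> q i \<le> p" for p q
    using that by (auto simp: C_def pt_def)
  \<comment> \<open>\<open>nr q t\<close> says that \<open>t\<close> is a vertex of the grid cell
    with lowest corner \<open>q\<close>; \<open>up\<close> and \<open>dn\<close> record the weak
    sign of \<open>f x - x\<close> in one coordinate at a grid point.\<close>
  define nr :: "(nat \<Rightarrow> nat) \<Rightarrow> (nat \<Rightarrow> nat) \<Rightarrow> bool"
    where "nr q t \<longleftrightarrow> (\<forall>j<n. q j \<le> t j \<and> t j \<le> q j + 1)" for q t
  define up where "up p t i \<longleftrightarrow> pt p t i \<le> f (pt p t) i" for p t i
  define dn where "dn p t i \<longleftrightarrow> f (pt p t) i \<le> pt p t i" for p t i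
  have grid: "\<exists>q. (\<forall>i<n. q i < Suc k) \<and>
      (\<forall>i<n. \<exists>r s. nr q r \<and> nr q s \<and> up (Suc k) r i \<and> dn (Suc k) s i)" for k
  proof -
    define p where "p = Suc k"
    have p: "0 < p" by (simp add: p_def)
    \<comment> \<open>The labels on the faces, 0 at \<open>x i = 0\<close> and 1 at
      \<open>x i = p\<close>, are those Kuhn's lemma prescribes. They still carry the right sign
      there, because the values of \<open>f\<close> lie in [0, 1].\<close>
    define label :: "(nat \<Rightarrow> nat) \<Rightarrow> nat \<Rightarrow> nat" where
      "label x i = (if x i = p \<or> (x i \<noteq> 0 \<and> f (pt p x) i < pt p x i) then 1 else 0)" for x i
    obtain q where q: "\<forall>i<n. q i < p" and lab: "\<forall>i<n. \<exists>r s. nr q r \<and> nr q s \<and> label r i \<noteq> label s i"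
      unfolding nr_def
      by (rule kuhn_lemma[OF p, where n = n and label = label]) (use p in \<open>auto simp: label_def\<close>)
    have nr_le: "x j \<le> p" if "nr q x" "j < n" for x j
      using that q unfolding nr_def by (metis Suc_eq_plus1 Suc_leI le_trans)
    have lab0: "up p x i" if "label x i = 0" "i < n" "nr q x" for x i
      using that range[OF pt_in[OF p nr_le[OF that(3)]] \<open>i < n\<close>]
      by (auto simp: label_def pt_def up_def split: if_splits)
    have lab1: "dn p x i" if "label x i = 1" "i < n" "nr q x" for x i
      using that p range[OF pt_in[OF p nr_le[OF that(3)]] \<open>i < n\<close>]
      by (auto simp: label_def pt_def dn_def split: if_splits)
    have "label x i = 0 \<or> label x i = 1" for x i
      by (simp add: label_def)
    then have "\<exists>r s. nr q r \<and> nr q s \<and> up p r i \<and> dn p s i" if "i < n" for i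
      using lab lab0 lab1 that by metis
    then show ?thesis using q unfolding p_def by blast
  qed
  then obtain q where q: "\<And>k i. i < n \<Longrightarrow> q k i < Suc k"
    and rs: "\<And>k i. i < n \<Longrightarrow> \<exists>r s. nr (q k) r \<and> nr (q k) s \<and> up (Suc k) r i \<and> dn (Suc k) s i"
    by metis
  have "\<forall>k. pt (Suc k) (q k) \<in> C"
    using q by (intro allI pt_in) (auto simp: less_imp_le)
  from seq_compactE[OF compact_imp_seq_compact[OF \<open>compact C\<close>] this]
  obtain x h where x: "x \<in> C" and h: "strict_mono h"
    and lim: "((\<lambda>k. pt (Suc k) (q k)) \<circ> h) \<longlonglongrightarrow> x" .
  \<comment> \<open>Any choice of one vertex per cell has the same limit as the lowest corners,
    since each coordinate differs by at most the mesh \<open>1 / Suc (h k)\<close>.\<close>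
  have near: "(\<lambda>k. pt (Suc (h k)) (t (h k))) \<longlonglongrightarrow> x"
    if t: "\<And>k. nr (q k) (t k)" for t
    unfolding tendsto_coordinatewise_iff
  proof
    fix j
    have l: "(\<lambda>k. pt (Suc (h k)) (q (h k)) j) \<longlonglongrightarrow> x j"
      using lim by (simp add: tendsto_coordinatewise_iff o_def)
    have "(\<lambda>k. pt (Suc (h k)) (t (h k)) j - pt (Suc (h k)) (q (h k)) j) \<longlonglongrightarrow> 0"
    proof (rule tendsto_sandwich[OF always_eventually always_eventually tendsto_const])
      show "(\<lambda>k. 1 / real (Suc (h k))) \<longlonglongrightarrow> 0"
        using LIMSEQ_subseq_LIMSEQ[OF LIMSEQ_inverse_real_of_nat h]
        by (simp add: o_def inverse_eq_divide)
    next
      show "\<forall>k. 0 \<le> pt (Suc (h k)) (t (h k)) j - pt (Suc (h k)) (q (h k)) j"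
        using t by (auto simp: nr_def pt_def intro!: divide_right_mono)
      have "real (t k j) \<le> real (q k j) + 1" if "j < n" for k
        using t[of k] that unfolding nr_def by (metis of_nat_1 of_nat_add of_nat_mono)
      then show "\<forall>k. pt (Suc (h k)) (t (h k)) j - pt (Suc (h k)) (q (h k)) j \<le> 1 / real (Suc (h k))"
        by (auto simp: pt_def add.commute diff_le_eq simp flip: add_divide_distrib intro!: divide_right_mono)
    qed
    from tendsto_add[OF this l] show "(\<lambda>k. pt (Suc (h k)) (t (h k)) j) \<longlonglongrightarrow> x j"
      by simp
  qed
  have "f x i = x i" if i: "i < n" for i
  proof (rule antisym)
    have "\<forall>k. \<exists>r. nr (q k) r \<and> up (Suc k) r i" "\<forall>k. \<exists>s. nr (q k) s \<and> dn (Suc k) s i"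
      using rs[OF i] by blast+
    then obtain r s where r: "\<And>k. nr (q k) (r k)" "\<And>k. up (Suc k) (r k) i"
      and s: "\<And>k. nr (q k) (s k)" "\<And>k. dn (Suc k) (s k) i"
      by metis
    have lims: "(\<lambda>k. f (pt (Suc (h k)) (t (h k))) i) \<longlonglongrightarrow> f x i"
      "(\<lambda>k. pt (Suc (h k)) (t (h k)) i) \<longlonglongrightarrow> x i"
      if t: "\<And>k. nr (q k) (t k)" for t
    proof -
      have "t k j \<le> Suc k" if "j < n" for k j
        using t[of k] q[OF that, of k] that unfolding nr_def by (metis Suc_eq_plus1 Suc_leI le_trans)
      then have "pt (Suc (h k)) (t (h k)) \<in> C" for k
        by (intro pt_in) auto
      then show "(\<lambda>k. f (pt (Suc (h k)) (t (h k))) i) \<longlonglongrightarrow> f x i"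
        using continuous_on_tendsto_compose[OF cont[OF i] near[OF t] x] by simp
      show "(\<lambda>k. pt (Suc (h k)) (t (h k)) i) \<longlonglongrightarrow> x i"
        using near[OF t] by (simp add: tendsto_coordinatewise_iff)
    qed
    show "f x i \<le> x i"
      using LIMSEQ_le[OF lims[OF s(1)]] s(2) unfolding dn_def by blast
    show "x i \<le> f x i"
      using LIMSEQ_le[OF lims(2,1)[OF r(1)]] r(2) unfolding up_def by blast
  qed
  then show thesis using that x by blast
qed

section \<open>Partitions of unity and Schauder's fixed point theorem\<close>

lemma finite_net_indexed:
  fixes Q :: "'a::metric_space set"
  assumes "compact Q" "Q \<noteq> {}" "0 < e"
  obtains n :: nat and b :: "nat \<Rightarrow> 'a" where "0 < n" "b ` {..<n} \<subseteq> Q" "Q \<subseteq> (\<Union>i<n. ball (b i) e)"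
proof -
  have "\<exists>k\<subseteq>Q. finite k \<and> Q \<subseteq> (\<Union>x\<in>k. ball x e)"
    by (rule compactE_image[OF \<open>compact Q\<close>, of Q "\<lambda>x. ball x e"]) (use \<open>0 < e\<close> in auto)
  then obtain k where k: "k \<subseteq> Q" "finite k" "Q \<subseteq> (\<Union>x\<in>k. ball x e)"
    by blast
  obtain n :: nat and b where "k = b ` {i. i < n}"
    using finite_imp_nat_seg_image_inj_on[OF k(2)] by blast
  moreover have "n > 0"
    using calculation k \<open>Q \<noteq> {}\<close> by (intro gr0I) auto
  ultimately show thesis
    using that[of n b] k by (auto simp: lessThan_def)
qed

text \<open>Tent functions \<open>max 0 (e - dist x (b i))\<close> around the points of a finite net
  are divided by their sum, which is positive on \<open>Q\<close> because the net covers it.\<close>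

lemma partition_of_unity_net:
  fixes Q :: "'a::metric_space set"
  assumes "compact Q" "Q \<noteq> {}" "0 < e"
  obtains n :: nat and b :: "nat \<Rightarrow> 'a" and \<phi> :: "nat \<Rightarrow> 'a \<Rightarrow> real"
  where "0 < n" "\<forall>i<n. b i \<in> Q" "\<forall>i. continuous_on Q (\<phi> i)"
    "\<forall>x\<in>Q. \<forall>i. 0 \<le> \<phi> i x" "\<forall>x\<in>Q. (\<Sum>i<n. \<phi> i x) = 1"
    "\<forall>x\<in>Q. \<forall>i. \<phi> i x \<noteq> 0 \<longrightarrow> dist x (b i) < e"
proof -
  obtain n :: nat and b where n: "0 < n" and b: "b ` {..<n} \<subseteq> Q" and cov: "Q \<subseteq> (\<Union>i<n. ball (b i) e)"
    by (rule finite_net_indexed[OF assms])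
  define \<psi> where "\<psi> i x = max 0 (e - dist x (b i))" for i x
  have pos: "(\<Sum>i<n. \<psi> i x) > 0" if "x \<in> Q" for x
  proof -
    obtain i where "i < n" "dist x (b i) < e"
      using cov \<open>x \<in> Q\<close> by (auto simp: dist_commute)
    then show ?thesis
      by (intro sum_pos2[of _ i]) (auto simp: \<psi>_def)
  qed
  show thesis
  proof (rule that[of n b "\<lambda>i x. \<psi> i x / (\<Sum>i<n. \<psi> i x)"])
    have "continuous_on Q (\<psi> j)" for j
      unfolding \<psi>_def by (intro continuous_intros)
    then show "\<forall>i. continuous_on Q (\<lambda>x. \<psi> i x / (\<Sum>i<n. \<psi> i x))"
      using pos by (intro allI continuous_intros) (auto simp: less_imp_neq[symmetric] order.strict_implies_not_eq)
    show "\<forall>x\<in>Q. \<forall>i. 0 \<le> \<psi> i x / (\<Sum>i<n. \<psi> i x)"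
      by (auto simp: \<psi>_def intro!: divide_nonneg_nonneg sum_nonneg)
    show "\<forall>x\<in>Q. (\<Sum>i<n. \<psi> i x / (\<Sum>i<n. \<psi> i x)) = 1"
      using pos by (force simp flip: sum_divide_distrib)
    show "\<forall>x\<in>Q. \<forall>i. \<psi> i x / (\<Sum>i<n. \<psi> i x) \<noteq> 0 \<longrightarrow> dist x (b i) < e"
      by (auto simp: \<psi>_def max_def)
  qed (use n b in auto)
qed

text \<open>The Schauder projection, sending \<open>z\<close> to the sum of the
  \<open>\<phi> i z *\<^sub>R b i\<close>, moves every point of \<open>Q\<close> by less than
  \<open>e\<close>. Brouwer's theorem is applied to its coefficients: \<open>\<alpha>\<close> goes
  to the weights of \<open>f (Y \<alpha>)\<close>, where \<open>Y \<alpha>\<close> is the point of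
  \<open>Q\<close> that \<open>\<alpha>\<close> encodes.\<close>

lemma schauder_approximate_fixpoint:
  fixes Q :: "'a::real_normed_vector set"
  assumes "compact Q" "convex Q" "Q \<noteq> {}" and f: "continuous_on Q f" "f ` Q \<subseteq> Q" and "0 < e"
  obtains y where "y \<in> Q" "dist (f y) y < e"
proof -
  obtain n :: nat and b and \<phi> :: "nat \<Rightarrow> 'a \<Rightarrow> real"
    where n: "0 < n" and b[rule_format]: "\<forall>i<n. b i \<in> Q"
    and \<phi>[rule_format]: "\<forall>i. continuous_on (Q) (\<phi> i)" "\<forall>x\<in>Q. \<forall>i. 0 \<le> \<phi> i x"
    "\<forall>x\<in>Q. (\<Sum>i<n. \<phi> i x) = 1" "\<forall>x\<in>Q. \<forall>i. \<phi> i x \<noteq> 0 \<longrightarrow> dist x (b i) < e"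
    by (rule partition_of_unity_net[OF assms(1,3,6)]) (rule that)
  define C where "C = {x::nat \<Rightarrow> real. (\<forall>i<n. x i \<in> {0..1}) \<and> (\<forall>i\<ge>n. x i = 0)}"
  define \<sigma> where "\<sigma> \<alpha> = (\<Sum>i<n. \<alpha> i)" for \<alpha> :: "nat \<Rightarrow> real"
  \<comment> \<open>The cube is retracted onto the simplex by dividing by a sum above 1 and moving the missing mass to vertex 0.\<close>
  define wt where "wt \<alpha> i = (\<alpha> i + (if i = 0 then max 0 (1 - \<sigma> \<alpha>) else 0)) / max 1 (\<sigma> \<alpha>)"
    for \<alpha> and i :: nat
  define Y where "Y \<alpha> = (\<Sum>i<n. wt \<alpha> i *\<^sub>R b i)" for \<alpha>
  have wt_sum: "(\<Sum>i<n. wt \<alpha> i) = 1" for \<alpha>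
  proof -
    have "(\<Sum>i<n. wt \<alpha> i) = (\<sigma> \<alpha> + max 0 (1 - \<sigma> \<alpha>)) / max 1 (\<sigma> \<alpha>)"
      using n by (simp add: wt_def sum.distrib \<sigma>_def flip: sum_divide_distrib)
    then show ?thesis by (auto simp: max_def)
  qed
  have Y_in: "Y \<alpha> \<in> Q" if "\<alpha> \<in> C" for \<alpha>
    unfolding Y_def using that wt_sum b \<open>convex Q\<close>
    by (intro convex_sum) (auto simp: wt_def C_def)
  have coord: "continuous_on A (\<lambda>\<alpha>. \<alpha> i)" for A and i :: nat
    by (rule continuous_on_subset[OF continuous_on_product_coordinates]) auto
  have "continuous_on C \<sigma>"
    unfolding \<sigma>_def by (intro continuous_intros coord)
  then have "continuous_on C (\<lambda>\<alpha>. wt \<alpha> i)" for i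
    unfolding wt_def by (cases "i = 0") (auto intro!: continuous_intros coord)
  then have "continuous_on C Y"
    unfolding Y_def by (intro continuous_intros)
  then have fY: "continuous_on C (\<lambda>\<alpha>. f (Y \<alpha>))"
    by (rule continuous_on_compose2[OF f(1)]) (use Y_in in auto)
  have fY_in: "f (Y \<alpha>) \<in> Q" if "\<alpha> \<in> C" for \<alpha>
    using Y_in[OF that] f(2) by auto
  obtain \<alpha> where \<alpha>: "\<alpha> \<in> C" "\<And>i. i < n \<Longrightarrow> \<phi> i (f (Y \<alpha>)) = \<alpha> i"
  proof (rule brouwer_nat_cube[of n "\<lambda>\<alpha> i. \<phi> i (f (Y \<alpha>))", folded C_def])
    show "continuous_on C (\<lambda>\<alpha>. \<phi> i (f (Y \<alpha>)))" for i
      by (rule continuous_on_compose2[OF \<phi>(1) fY]) (use fY_in in auto)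
    show "\<phi> i (f (Y \<alpha>)) \<in> {0..1}" if "\<alpha> \<in> C" "i < n" for \<alpha> i
      using \<phi>(2,3)[OF fY_in[OF that(1)]] member_le_sum[of i "{..<n}" "\<lambda>i. \<phi> i (f (Y \<alpha>))"] that by auto
  qed blast
  define z where "z = f (Y \<alpha>)"
  have z: "z \<in> Q" using fY_in \<alpha> z_def by auto
  \<comment> \<open>A fixed coefficient vector consists of partition weights, hence already lies in
    the simplex; there \<open>wt\<close> changes nothing, so \<open>Y \<alpha>\<close> is the
    Schauder projection of \<open>z\<close>.\<close>
  have "\<sigma> \<alpha> = 1"
    using \<phi>(3)[OF z] \<alpha>(2) by (simp add: \<sigma>_def z_def)
  then have Y: "Y \<alpha> = (\<Sum>i<n. \<phi> i z *\<^sub>R b i)"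
    unfolding Y_def wt_def using \<alpha>(2) by (intro sum.cong) (auto simp: z_def)
  \<comment> \<open>Zero weights are dropped first: only the \<open>b i\<close> with nonzero weight
    are known to lie in the ball.\<close>
  have "(\<Sum>i\<in>{i. i < n \<and> \<phi> i z \<noteq> 0}. \<phi> i z *\<^sub>R b i) \<in> ball z e"
    using \<phi>(2-4)[OF z] by (intro convex_sum) (auto intro: trans[OF sum.mono_neutral_left])
  also have "(\<Sum>i\<in>{i. i < n \<and> \<phi> i z \<noteq> 0}. \<phi> i z *\<^sub>R b i) = Y \<alpha>"
    unfolding Y by (rule sum.mono_neutral_left) auto
  finally show thesis
    using that[of "Y \<alpha>"] Y_in \<alpha>(1) by (simp add: z_def)
qed

text \<open>The displacement attains its minimum on the compact set; a positive minimum, taken as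
  \<open>e\<close>, would contradict the approximate version.\<close>

theorem schauder_fixpoint:
  fixes Q :: "'a::real_normed_vector set"
  assumes Q: "compact Q" "convex Q" "Q \<noteq> {}" and f: "continuous_on Q f" "f ` Q \<subseteq> Q"
  obtains y where "y \<in> Q" "f y = y"
proof -
  have "continuous_on Q (\<lambda>y. dist (f y) y)"
    using f(1) by (intro continuous_intros)
  then obtain y where y: "y \<in> Q" "\<And>z. z \<in> Q \<Longrightarrow> dist (f y) y \<le> dist (f z) z"
    using continuous_attains_inf[OF Q(1,3)] by blast
  have "dist (f y) y = 0"
  proof (rule ccontr)
    assume "dist (f y) y \<noteq> 0"
    then have "0 < dist (f y) y" by simp
    from schauder_approximate_fixpoint[OF Q f this] y(2) show False by (metis not_less)
  qed
  with y(1) that show thesis by simp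
qed

section \<open>Mazur's theorem on closed convex hulls of compact sets\<close>

text \<open>A finite net \<open>k\<close> of \<open>S\<close> has a compact convex hull, and a
  finite net \<open>k'\<close> of that hull also serves for the closed hull of \<open>S\<close>:
  three errors of \<open>e/4\<close> stay below \<open>e\<close>. Completeness comes from the Banach
  space.\<close>

theorem compact_closure_convex_hull:
  fixes S :: "'a::banach set"
  assumes "compact S"
  shows "compact (closure (convex hull S))"
  unfolding compact_eq_totally_bounded
proof (intro conjI allI impI)
  show "complete (closure (convex hull S))"
    by (simp add: complete_eq_closed)
  fix e :: real assume "0 < e"
  obtain k where k: "finite k" "S \<subseteq> (\<Union>x\<in>k. ball x (e/4))"
    using \<open>compact S\<close> \<open>0 < e\<close> unfolding compact_eq_totally_bounded by (meson divide_pos_pos zero_less_numeral)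
  obtain k' where k': "finite k'" "convex hull k \<subseteq> (\<Union>x\<in>k'. ball x (e/4))"
    using finite_imp_compact_convex_hull[OF k(1)] \<open>0 < e\<close> unfolding compact_eq_totally_bounded
    by (meson divide_pos_pos zero_less_numeral)
  \<comment> \<open>The right-hand side is convex, so the inclusion passes from \<open>S\<close> to
    its convex hull.\<close>
  have "S \<subseteq> convex hull k + ball 0 (e/4)"
  proof
    fix x assume "x \<in> S"
    then obtain c where "c \<in> k" "dist c x < e/4" using k by auto
    then show "x \<in> convex hull k + ball 0 (e/4)"
      by (intro set_plus_intro[of c _ "x - c", simplified]) (auto simp: hull_inc dist_norm norm_minus_commute)
  qed
  then have hull: "convex hull S \<subseteq> convex hull k + ball 0 (e/4)"
    by (rule hull_minimal) (intro convex_set_plus convex_convex_hull convex_ball)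
  have "closure (convex hull S) \<subseteq> (\<Union>x\<in>k'. ball x e)"
  proof
    fix x assume "x \<in> closure (convex hull S)"
    then obtain y where y: "y \<in> convex hull S" "dist y x < e/4"
      using \<open>0 < e\<close> unfolding closure_approachable by (metis divide_pos_pos zero_less_numeral)
    then obtain c d where c: "c \<in> convex hull k" "norm d < e/4" "y = c + d"
      using hull by (auto elim!: set_plus_elim dest!: subsetD)
    then obtain c' where "c' \<in> k'" "dist c' c < e/4" using k' by auto
    moreover have "dist c y < e/4" using c by (simp add: dist_norm)
    ultimately have "dist c' x < e" using y(2) \<open>0 < e\<close>
      using dist_triangle[of c' x c] dist_triangle[of c x y] by linarith
    then show "x \<in> (\<Union>x\<in>k'. ball x e)" using \<open>c' \<in> k'\<close> by auto
  qed
  then show "\<exists>k. finite k \<and> closure (convex hull S) \<subseteq> (\<Union>x\<in>k. ball x e)"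
    using k'(1) by blast
qed

section \<open>Continuous approximation of the closed-convex envelope\<close>

lemma envelope_approx_selection:
  fixes T :: "'a::real_normed_vector \<Rightarrow> 'b::real_normed_vector"
  assumes Q: "compact Q" "Q \<noteq> {}" and p: "continuous_on Q p" "p ` Q \<subseteq> D" and "0 < e"
  obtains f where "continuous_on Q f" "\<And>y. y \<in> Q \<Longrightarrow> f y \<in> convex hull (T ` (cball (p y) e \<inter> D))"
proof -
  have pQ: "compact (p ` Q)" "p ` Q \<noteq> {}"
    using Q p by (auto intro: compact_continuous_image)
  obtain n :: nat and b and \<phi> :: "nat \<Rightarrow> 'a \<Rightarrow> real"
    where n: "0 < n" and b[rule_format]: "\<forall>i<n. b i \<in> p ` Q"
    and \<phi>[rule_format]: "\<forall>i. continuous_on (p ` Q) (\<phi> i)" "\<forall>x\<in>p ` Q. \<forall>i. 0 \<le> \<phi> i x"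
    "\<forall>x\<in>p ` Q. (\<Sum>i<n. \<phi> i x) = 1" "\<forall>x\<in>p ` Q. \<forall>i. \<phi> i x \<noteq> 0 \<longrightarrow> dist x (b i) < e"
    by (rule partition_of_unity_net[OF pQ \<open>0 < e\<close>]) (rule that)
  show thesis
  proof (rule that[of "\<lambda>y. \<Sum>i<n. \<phi> i (p y) *\<^sub>R T (b i)"])
    have "continuous_on Q (\<lambda>y. \<phi> i (p y))" for i
      by (rule continuous_on_compose2[OF \<phi>(1) p(1)]) auto
    then show "continuous_on Q (\<lambda>y. \<Sum>i<n. \<phi> i (p y) *\<^sub>R T (b i))"
      by (intro continuous_intros)
    fix y assume "y \<in> Q"
    then have y: "p y \<in> p ` Q" by auto
    have "T (b i) \<in> convex hull (T ` (cball (p y) e \<inter> D))" if "i < n" "\<phi> i (p y) \<noteq> 0" for i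
      using \<phi>(4)[OF y that(2)] b[OF that(1)] p(2) by (intro hull_inc imageI) auto
    then have "(\<Sum>i\<in>{i. i < n \<and> \<phi> i (p y) \<noteq> 0}. \<phi> i (p y) *\<^sub>R T (b i))
        \<in> convex hull (T ` (cball (p y) e \<inter> D))"
      using \<phi>(2,3)[OF y] by (intro convex_sum) (auto intro: trans[OF sum.mono_neutral_left])
    also have "(\<Sum>i\<in>{i. i < n \<and> \<phi> i (p y) \<noteq> 0}. \<phi> i (p y) *\<^sub>R T (b i))
        = (\<Sum>i<n. \<phi> i (p y) *\<^sub>R T (b i))"
      by (rule sum.mono_neutral_left) auto
    finally show "(\<Sum>i<n. \<phi> i (p y) *\<^sub>R T (b i)) \<in> convex hull (T ` (cball (p y) e \<inter> D))" .
  qed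
qed

text \<open>This is the closed graph property of the envelope. For fixed \<open>\<epsilon>\<close>
  the moving balls eventually lie in \<open>cball a \<epsilon>\<close>, and the closed hull over
  that ball keeps the limit.\<close>

lemma cc_envelope_limit:
  assumes x: "x \<longlonglongrightarrow> a" and v: "v \<longlonglongrightarrow> b" and e: "e \<longlonglongrightarrow> 0"
    and mem: "\<And>n. v n \<in> convex hull (T ` (cball (x n) (e n) \<inter> D))"
  shows "b \<in> cc_envelope T D a"
  unfolding cc_envelope_def
proof (intro INT_I)
  fix \<epsilon> :: real assume "\<epsilon> \<in> {0<..}"
  then have "0 < \<epsilon>" by simp
  have "(\<lambda>n. dist (x n) a + e n) \<longlonglongrightarrow> 0"
    using tendsto_add[OF tendsto_dist[OF x tendsto_const[of a]] e] by simp
  then have "\<forall>\<^sub>F n in sequentially. dist (x n) a + e n < \<epsilon>"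
    using \<open>0 < \<epsilon>\<close> by (rule order_tendstoD)
  then have "\<forall>\<^sub>F n in sequentially. v n \<in> closure (convex hull (T ` (cball a \<epsilon> \<inter> D)))"
  proof eventually_elim
    case (elim n)
    have "cball (x n) (e n) \<subseteq> cball a \<epsilon>"
    proof
      fix z assume "z \<in> cball (x n) (e n)"
      then show "z \<in> cball a \<epsilon>"
        using elim dist_triangle[of a z "x n"] by (simp add: dist_commute)
    qed
    then have "convex hull (T ` (cball (x n) (e n) \<inter> D)) \<subseteq> convex hull (T ` (cball a \<epsilon> \<inter> D))"
      by (intro hull_mono) auto
    then show ?case using mem[of n] closure_subset by blast
  qed
  then show "b \<in> closure (convex hull (T ` (cball a \<epsilon> \<inter> D)))"
    using Lim_in_closed_set[OF closed_closure _ _ v] by simp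
qed

text \<open>Schauder's theorem is applied to \<open>\<Phi> y (f y)\<close> with approximate
  selections \<open>f\<close> of radius \<open>1 / Suc n\<close>. Compactness of
  \<open>Q \<times> M\<close> lets points and selected values converge together, and the closed
  graph places the limit value in the envelope.\<close>

lemma cc_envelope_fixpoint:
  fixes T :: "'a::banach \<Rightarrow> 'a" and \<Phi> :: "'a \<Rightarrow> 'a \<Rightarrow> 'a"
  assumes Q: "compact Q" "convex Q" "Q \<noteq> {}"
    and p: "continuous_on Q p" "p ` Q \<subseteq> D"
    and M: "compact M" "convex hull (T ` D) \<subseteq> M"
    and \<Phi>: "continuous_on (Q \<times> M) (\<lambda>z. \<Phi> (fst z) (snd z))"
      "\<And>y v. y \<in> Q \<Longrightarrow> v \<in> convex hull (T ` D) \<Longrightarrow> \<Phi> y v \<in> Q"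
  obtains y v where "y \<in> Q" "v \<in> M" "v \<in> cc_envelope T D (p y)" "\<Phi> y v = y"
proof -
  have "\<exists>y v. y \<in> Q \<and> v \<in> M \<and> v \<in> convex hull (T ` (cball (p y) (1 / real (Suc n)) \<inter> D)) \<and> \<Phi> y v = y" for n
  proof -
    obtain f where f: "continuous_on Q f"
      "\<And>y. y \<in> Q \<Longrightarrow> f y \<in> convex hull (T ` (cball (p y) (1 / real (Suc n)) \<inter> D))"
      by (rule envelope_approx_selection[OF Q(1,3) p, of "1 / real (Suc n)" T]) auto
    have sub: "convex hull (T ` (cball (p y) (1 / real (Suc n)) \<inter> D)) \<subseteq> convex hull (T ` D)" for y
      by (intro hull_mono) auto
    have fM: "f y \<in> convex hull (T ` D)" "f y \<in> M" if "y \<in> Q" for y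
      using f(2)[OF that] sub M(2) by auto
    have "continuous_on Q (\<lambda>y. \<Phi> y (f y))"
      using continuous_on_compose2[OF \<Phi>(1) continuous_on_Pair[OF continuous_on_id f(1)]] fM by auto
    then obtain y where "y \<in> Q" "\<Phi> y (f y) = y"
      using schauder_fixpoint[OF Q, of "\<lambda>y. \<Phi> y (f y)"] \<Phi>(2) fM by blast
    then show ?thesis using f(2) fM by blast
  qed
  then obtain y v where yv: "\<And>n. (y n, v n) \<in> Q \<times> M"
    "\<And>n. v n \<in> convex hull (T ` (cball (p (y n)) (1 / real (Suc n)) \<inter> D))" "\<And>n. \<Phi> (y n) (v n) = y n"
    by (simp add: mem_Times_iff) metis
  from seq_compactE[OF compact_imp_seq_compact[OF compact_Times[OF Q(1) M(1)]] allI[OF yv(1)]]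
  obtain z h where z: "z \<in> Q \<times> M" and h: "strict_mono (h :: nat \<Rightarrow> nat)"
    and lim: "((\<lambda>n. (y n, v n)) \<circ> h) \<longlonglongrightarrow> z" .
  obtain a b where ab: "z = (a, b)" by fastforce
  have ya: "(\<lambda>n. y (h n)) \<longlonglongrightarrow> a" and vb: "(\<lambda>n. v (h n)) \<longlonglongrightarrow> b"
    using tendsto_fst[OF lim] tendsto_snd[OF lim] by (simp_all add: ab o_def)
  have "(\<lambda>n. \<Phi> (y (h n)) (v (h n))) \<longlonglongrightarrow> \<Phi> a b"
    using continuous_on_tendsto_compose[OF \<Phi>(1) lim z] yv(1) by (simp add: ab o_def)
  then have "\<Phi> a b = a"
    using yv(3) ya LIMSEQ_unique by simp
  moreover have "b \<in> cc_envelope T D (p a)"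
  proof (rule cc_envelope_limit)
    show "(\<lambda>n. p (y (h n))) \<longlonglongrightarrow> p a"
      using continuous_on_tendsto_compose[OF p(1) ya] z yv(1) by (simp add: ab)
    show "(\<lambda>n. 1 / real (Suc (h n))) \<longlonglongrightarrow> 0"
      using LIMSEQ_subseq_LIMSEQ[OF LIMSEQ_inverse_real_of_nat h] by (simp add: o_def inverse_eq_divide)
  qed (use vb yv(2) in auto)
  ultimately show thesis
    using that z ab by auto
qed

section \<open>The fixed point between the two radii\<close>

theorem theorem3:
  fixes K :: "'a::banach set" and T :: "'a \<Rightarrow> 'a" and r1 r2 R :: real
  assumes cone: "is_cone K"
    and pos: "r1 > 0" "r2 > 0" "R > 0"
    and le: "r1 \<le> R" "r2 \<le> R"
    and neq: "r1 \<noteq> r2"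
    and maps: "T ` (cball 0 R \<inter> K) \<subseteq> K"
    and relcpt: "compact (closure (T ` (cball 0 R \<inter> K)))"
    and env: "\<forall>x\<in>cball 0 R \<inter> K. {x} \<inter> cc_envelope T (cball 0 R \<inter> K) x \<subseteq> {T x}"
    and a: "\<forall>x\<in>K. norm x = r1 \<longrightarrow> (\<forall>l::real. l \<ge> 1 \<longrightarrow>
              l *\<^sub>R x \<notin> cc_envelope T (cball 0 R \<inter> K) x)"
    and b: "\<exists>w\<in>K. norm w \<noteq> 0 \<and> (\<forall>l::real. l \<ge> 0 \<longrightarrow> (\<forall>x\<in>K. norm x = r2 \<longrightarrow>
              x \<notin> (\<lambda>y. y + l *\<^sub>R w) ` cc_envelope T (cball 0 R \<inter> K) x))"
  shows "\<exists>x\<in>K. T x = x \<and> min r1 r2 < norm x \<and> norm x < max r1 r2"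
proof -
  define D where "D = cball 0 R \<inter> K"
  have K: "closed K" "convex K" "\<And>x l. x \<in> K \<Longrightarrow> 0 \<le> l \<Longrightarrow> l *\<^sub>R x \<in> K"
    using cone by (auto simp: is_cone_def)
  obtain w where w: "w \<in> K" "w \<noteq> 0"
    and bw: "\<And>l x v. 0 \<le> l \<Longrightarrow> x \<in> K \<Longrightarrow> norm x = r2 \<Longrightarrow> v \<in> cc_envelope T D x \<Longrightarrow> x \<noteq> v + l *\<^sub>R w"
    using b unfolding D_def by fastforce
  have "0 \<in> K" using K(3)[OF w(1), of 0] by simp
  define C where "C = closure (T ` D)"
  define M where "M = closure (convex hull C)"
  have TD_C: "T ` D \<subseteq> C" unfolding C_def by (rule closure_subset)
  have "compact C" using relcpt by (simp add: C_def D_def)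
  then have M: "compact M" unfolding M_def by (rule compact_closure_convex_hull)
  have hull_M: "convex hull (T ` D) \<subseteq> M"
    unfolding M_def C_def by (meson closure_subset hull_mono order_trans)
  obtain B where B: "0 < B" "\<And>v. v \<in> M \<Longrightarrow> norm v \<le> B"
    using compact_imp_bounded[OF M] bounded_pos by metis

  define q where "q s = r2 + max 0 (s - 1) * (r1 - r2)" for s :: real
  define m where "m = min r1 r2"
  have "0 < m" using pos by (simp add: m_def)
  have q_bounds: "m \<le> q s" "q s \<le> R" if "s \<le> 2" for s
  proof -
    define t where "t = max 0 (s - 1)"
    have t: "0 \<le> t" "t \<le> 1" using that by (auto simp: t_def)
    have eq: "q s = (1 - t) * r2 + t * r1" by (simp add: q_def t_def algebra_simps)
    show "m \<le> q s"
      using convex_bound_le[of "- r2" "- m" "- r1" "1 - t" t] t by (simp add: eq m_def)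
    show "q s \<le> R"
      using convex_bound_le[of r2 R r1 "1 - t" t] t le by (simp add: eq)
  qed

  define d where "d s = max 0 (1 - s)" for s :: real
  \<comment> \<open>\<open>L\<close> bounds the rescaling factor \<open>s / q s\<close> on [0, 2],
    where \<open>q s\<close> is at least \<open>m\<close>.\<close>
  define L where "L = 2 / m"
  \<comment> \<open>The doubled generators make \<open>c *\<^sub>R v + e *\<^sub>R w\<close> a
    midpoint of two points of the hull whenever \<open>c \<le> L\<close> and
    \<open>e \<le> 1\<close>; the generator 0 allows scaling down, in particular by the radial
    retraction.\<close>
  define Q where "Q = cball 0 2 \<inter> closure (convex hull (insert 0 (insert (2 *\<^sub>R w) ((*\<^sub>R) (2 * L) ` C))))"
  have "0 < L" using \<open>0 < m\<close> by (simp add: L_def)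
  have c_bounds: "0 \<le> s / q s" "s / q s \<le> L" if "0 \<le> s" "s \<le> 2" for s
    using that q_bounds(1)[OF that(2)] \<open>0 < m\<close> by (auto simp: L_def intro!: divide_nonneg_nonneg frac_le)

  have Q: "compact Q" "convex Q" "0 \<in> Q"
  proof -
    have "compact ((*\<^sub>R) (2 * L) ` C)"
      using \<open>compact C\<close> by (rule compact_scaling)
    then show "compact Q"
      unfolding Q_def by (intro closed_Int_compact compact_closure_convex_hull compact_insert) auto
    show "convex Q"
      unfolding Q_def by (intro convex_Int convex_closure) auto
    show "0 \<in> Q"
      unfolding Q_def using closure_subset by (auto intro!: subsetD[OF closure_subset] hull_inc)
  qed
  have "C \<subseteq> K"
    unfolding C_def using maps K(1) by (simp add: closure_minimal D_def)
  then have QK: "Q \<subseteq> K"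
    unfolding Q_def using K(3) \<open>0 \<in> K\<close> w(1) \<open>0 < L\<close>
    by (intro le_infI2 closure_minimal hull_minimal K(1,2)) auto

  define \<Phi> where "\<Phi> y v = (let z = (norm y / q (norm y)) *\<^sub>R v + d (norm y) *\<^sub>R w in (2 / max 2 (norm z)) *\<^sub>R z)"
    for y v :: 'a
  have \<Phi>_in: "\<Phi> y v \<in> Q" if y: "y \<in> Q" and v: "v \<in> convex hull (T ` D)" for y v
  proof -
    define H where "H = convex hull (insert 0 (insert (2 *\<^sub>R w) ((*\<^sub>R) (2 * L) ` C)))"
    define c where "c = norm y / q (norm y)"
    define e where "e = d (norm y)"
    define z where "z = c *\<^sub>R v + e *\<^sub>R w"
    have y2: "norm y \<le> 2" using y by (simp add: Q_def)
    have c: "0 \<le> c" "c \<le> L" using c_bounds y2 by (simp_all add: c_def)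
    have e: "0 \<le> e" "e \<le> 1" by (simp_all add: e_def d_def)
    have H: "convex H" "0 \<in> H" "2 *\<^sub>R w \<in> H" by (auto simp: H_def hull_inc)
    have "(2 * L) *\<^sub>R v \<in> convex hull ((*\<^sub>R) (2 * L) ` T ` D)"
      unfolding convex_hull_scaling using v by (rule imageI)
    also have "\<dots> \<subseteq> H"
      unfolding H_def using TD_C by (intro hull_mono subset_insertI2 image_mono)
    finally have v': "(2 * L) *\<^sub>R v \<in> H" .
    define t where "t = c / (2 * L)"
    have t: "0 \<le> t" "t \<le> 1 / 2" "t * (2 * L) = c" using c \<open>0 < L\<close> by (auto simp: t_def field_simps)
    have scale0: "k *\<^sub>R x \<in> H" if "x \<in> H" "0 \<le> k" "k \<le> 1" for k x
      using convexD[OF H(1) that(1) H(2), of k "1 - k"] that by simp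
    have "(2 * t) *\<^sub>R (2 * L) *\<^sub>R v \<in> H" "e *\<^sub>R 2 *\<^sub>R w \<in> H"
      using t e v' H(3) by (auto intro!: scale0 simp del: scaleR_scaleR)
    from convexD[OF H(1) this, of "1/2" "1/2"] have "z \<in> H"
      using t(3) by (simp add: z_def mult.assoc)
    then have "(2 / max 2 (norm z)) *\<^sub>R z \<in> H"
      by (intro scale0) auto
    moreover have "norm ((2 / max 2 (norm z)) *\<^sub>R z) \<le> 2"
      by (simp add: field_simps)
    ultimately show ?thesis
      using closure_subset by (auto simp: \<Phi>_def Let_def Q_def H_def z_def c_def e_def)
  qed

  have q_cont: "continuous_on A (\<lambda>y. q (g y))" if "continuous_on A g" for A :: "'b::topological_space set" and g
    unfolding q_def using that by (intro continuous_intros)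
  have q_pos: "0 < q (norm y)" if "y \<in> Q" for y
    using q_bounds(1)[of "norm y"] that \<open>0 < m\<close> by (simp add: Q_def)
  have \<Phi>_cont: "continuous_on (Q \<times> M) (\<lambda>z. \<Phi> (fst z) (snd z))"
    unfolding \<Phi>_def Let_def d_def
    by (intro continuous_intros q_cont) (use q_pos in fastforce)+

  \<comment> \<open>Radial projection is discontinuous at 0, so p cuts |y| off at \<eta>; this is harmless because for
    |y| < \<eta> the term involving w is too large to allow a solution.\<close>
  define E where "E = 1 + norm w + B / r2"
  define \<eta> where "\<eta> = norm w / (2 * E)"
  have E: "norm w < E" using B(1) pos(2) by (simp add: E_def add_pos_nonneg)
  then have den: "0 < E" using norm_ge_zero[of w] by linarith
  have \<eta>: "0 < \<eta>" "\<eta> < 1" "\<eta> * E < norm w"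
    using w(2) E den by (auto simp: \<eta>_def divide_less_eq)
  define p where "p y = (q (norm y) / max \<eta> (norm y)) *\<^sub>R y" for y :: 'a
  have p_cont: "continuous_on Q p"
    unfolding p_def using \<eta>(1) by (intro continuous_intros q_cont) auto
  have p_in: "p ` Q \<subseteq> D"
  proof (rule image_subsetI)
    fix y assume y: "y \<in> Q"
    have "norm y / max \<eta> (norm y) \<le> 1" using \<eta>(1) by (simp add: divide_le_eq_1 less_max_iff_disj)
    then have "q (norm y) * (norm y / max \<eta> (norm y)) \<le> q (norm y)"
      using q_pos[OF y] by (intro mult_left_le) auto
    then have "norm (p y) \<le> R"
      using q_bounds(2)[of "norm y"] y q_pos[OF y] \<eta>(1) by (simp add: p_def Q_def)
    then show "p y \<in> D"
      using y QK q_pos[OF y] \<eta>(1) by (auto simp: D_def p_def intro!: K(3))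
  qed

  obtain y v where y: "y \<in> Q" and v: "v \<in> M" "v \<in> cc_envelope T D (p y)" and fp: "\<Phi> y v = y"
    by (rule cc_envelope_fixpoint[OF Q(1,2) _ p_cont p_in M hull_M \<Phi>_cont \<Phi>_in]) (use Q(3) in auto)
  define s where "s = norm y"
  define c where "c = s / q s"
  define z where "z = c *\<^sub>R v + d s *\<^sub>R w"
  have y_eq: "y = (2 / max 2 (norm z)) *\<^sub>R z"
    using fp by (simp add: \<Phi>_def Let_def s_def c_def z_def)
  have s: "0 \<le> s" "s \<le> 2" using y by (auto simp: s_def Q_def)
  have qs: "0 < q s" using q_pos[OF y] by (simp add: s_def)
  have s_min: "s = min 2 (norm z)"
    unfolding s_def by (subst y_eq) (auto simp: min_def max_def)
  \<comment> \<open>If \<open>s < \<eta>\<close>, the retraction is inactive and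
    \<open>q s = r2\<close>, so the fixed point equation gives
    \<open>(1 - s) * norm w \<le> s + s / r2 * B\<close>, that is \<open>norm w \<le> s * E\<close>.
    \<open>E\<close> collects these coefficients, and \<open>\<eta>\<close> was chosen with
    \<open>\<eta> * E < norm w\<close>.\<close>
  have "\<eta> \<le> s"
  proof (rule ccontr)
    assume "\<not> \<eta> \<le> s"
    then have "s < \<eta>" by simp
    then have "s = norm z" using s_min \<eta>(2) by auto
    have "c = s / r2" using \<open>s < \<eta>\<close> \<eta>(2) by (simp add: c_def q_def)
    have ds: "d s = 1 - s" using \<open>s < \<eta>\<close> \<eta>(2) by (simp add: d_def)
    have "d s *\<^sub>R w = z - c *\<^sub>R v" by (simp add: z_def)
    then have "(1 - s) * norm w \<le> norm z + norm (c *\<^sub>R v)"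
      using norm_triangle_ineq4[of z "c *\<^sub>R v"] \<open>s < \<eta>\<close> \<eta>(2) by (metis abs_of_pos diff_gt_0_iff_gt ds less_trans norm_scaleR)
    also have "norm (c *\<^sub>R v) \<le> s / r2 * B"
      using B(2)[OF v(1)] s pos(2) by (simp add: \<open>c = s / r2\<close> mult_left_mono divide_right_mono)
    finally have "norm w \<le> s * E"
      using \<open>s = norm z\<close> by (simp add: E_def algebra_simps)
    also have "\<dots> \<le> \<eta> * E"
      using \<open>s < \<eta>\<close> den by (intro mult_right_mono) auto
    finally show False using \<eta>(3) by simp
  qed
  then have "0 < s" using \<eta>(1) by simp
  then have "0 < c" using qs by (simp add: c_def)
  \<comment> \<open>From here on the cutoff in \<open>p\<close> is inactive: \<open>u\<close> is the
    exact multiple of \<open>y\<close> of norm \<open>q s\<close>, and \<open>y\<close> is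
    \<open>c\<close> times \<open>u\<close>.\<close>
  define u where "u = p y"
  have u_eq: "u = (1 / c) *\<^sub>R y"
    using \<open>\<eta> \<le> s\<close> by (simp add: u_def p_def c_def s_def max_def)
  have "u \<in> D" "v \<in> cc_envelope T D u"
    using p_in y v(2) by (auto simp: u_def)
  moreover have "norm u = q s"
    using \<open>0 < s\<close> qs by (simp add: u_eq c_def flip: s_def)
  ultimately have u: "norm u = q s" "u \<in> D" "u \<in> K" "v \<in> cc_envelope T D u"
    by (auto simp: D_def)
  have a': "l *\<^sub>R u \<noteq> v" if "q s = r1" "1 \<le> l" for l
    using a u that by (auto simp: D_def)
  \<comment> \<open>Were the retraction active, then \<open>s = 2\<close>, the \<open>w\<close> term
    would vanish and \<open>q s = r1\<close>; cancelling \<open>c\<close> leaves \<open>v\<close> as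
    \<open>u\<close> times \<open>norm z / 2 > 1\<close>, contrary to (a).\<close>
  have "norm z \<le> 2"
  proof (rule ccontr)
    assume "\<not> norm z \<le> 2"
    then have nz: "2 < norm z" and "s = 2" using s_min by auto
    then have "y = (2 / norm z) *\<^sub>R c *\<^sub>R v"
      by (subst y_eq) (simp add: z_def d_def)
    then have "u = (2 / norm z) *\<^sub>R v" using \<open>0 < c\<close> by (simp add: u_eq)
    then have "(norm z / 2) *\<^sub>R u = v" using nz by auto
    with a'[of "norm z / 2"] nz \<open>s = 2\<close> show False by (simp add: q_def)
  qed
  then have "y = c *\<^sub>R v + d s *\<^sub>R w"
    using y_eq by (simp add: z_def)
  then have u_sum: "u = v + (d s / c) *\<^sub>R w"
    using \<open>0 < c\<close> by (simp add: u_eq scaleR_add_right)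
  \<comment> \<open>For \<open>s \<le> 1\<close> the norm of \<open>u\<close> is \<open>r2\<close>,
    and \<open>u_sum\<close> is a relation forbidden by (b), with the nonnegative coefficient
    \<open>d s / c\<close>.\<close>
  have "1 < s"
  proof (rule ccontr)
    assume "\<not> 1 < s"
    then have "norm u = r2" by (simp add: u q_def)
    then show False
      using bw[of "d s / c" u v] u u_sum \<open>0 < c\<close> by (simp add: d_def)
  qed
  \<comment> \<open>Beyond radius 1 the \<open>w\<close> term is gone, so \<open>u\<close> lies in
    its own envelope. Condition (a) with factor 1 then rules out \<open>s = 2\<close>, and
    \<open>q s\<close> is strictly between the two radii.\<close>
  then have "u = v" using u_sum by (simp add: d_def)
  then have "s \<noteq> 2" using a'[of 1] by (auto simp: q_def)
  then have "s < 2" using s by simp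
  have "min r1 r2 < q s \<and> q s < max r1 r2"
  proof -
    define t where "t = s - 1"
    have t: "0 < t" "t < 1" using \<open>1 < s\<close> \<open>s < 2\<close> by (auto simp: t_def)
    have eq: "q s = r2 + t * (r1 - r2)" using \<open>1 < s\<close> by (simp add: q_def t_def)
    show ?thesis
    proof (cases "r1 < r2")
      case True
      then have "t * (r2 - r1) < r2 - r1" "0 < t * (r2 - r1)" using t by auto
      then show ?thesis using True by (auto simp: eq algebra_simps)
    next
      case False
      then have "0 < r1 - r2" using neq by simp
      then have "t * (r1 - r2) < r1 - r2" "0 < t * (r1 - r2)" using t by auto
      then show ?thesis using False by (auto simp: eq)
    qed
  qed
  moreover have "{u} \<inter> cc_envelope T D u \<subseteq> {T u}"
    using env u(2) unfolding D_def by blast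
  then have "T u = u"
    using u(4) \<open>u = v\<close> by auto
  ultimately show ?thesis using u by auto
qed

end
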